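(* Let $\Omega\subseteq\mathbb{R}^2$ be open and connected, let $f:\Omega\to\mathbb{R}$ be a minimal graph surface with $\|\nabla f\|^2$ nowhere zero on $\Omega$, and let $g:U\to\mathbb{R}$ (with $f(\Omega)\subseteq U$) be a minimal graph transformation of $f$ with $g'^3-g'$ nowhere zero on $U$. Suppose that the first characteristic function $h=\frac{g''}{g'^3-g'}$ is identically zero on $f(\Omega)$. Then $f$ is either a plane $$f(x,y)=\alpha x+\beta y+\gamma\qquad(\alpha,\beta,\gamma\in\mathbb{R}),$$ or a helicoid $$f(x,y)=-\frac{2}{\alpha}\tan^{-1}\!\Big(\frac{y+\gamma}{x+\beta}\Big)+\delta\qquad(\alpha,\beta,\gamma,\delta\in\mathbb{R},\ \alpha\neq0),$$ and on $f(\Omega)$ the transformation has the form $g(t)=at+b$ with $a,b\in\mathbb{R}$, $a\notin\{0,1,-1\}$. Consequently $g\circ f$ is again a plane, respectively a helicoid.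
   Context: A minimal graph surface is a smooth function $f:\Omega\to\mathbb{R}$ on an open connected set $\Omega\subseteq\mathbb{R}^2$ satisfying $(1+f_y^2)f_{xx}-2f_{xy}f_xf_y+(1+f_x^2)f_{yy}=0$. A smooth map $g:U\subseteq\mathbb{R}\to\mathbb{R}$ ($U$ open) is a minimal graph transformation of $f$ if $f(\Omega)\subseteq U$ and $g\circ f$ is again a minimal graph surface. Under the stated non-vanishing conditions one has $\Delta f/\|\nabla f\|^2=h(f)$ on $\Omega$ with $h=\frac{g''}{g'^3-g'}$; $h$ is called the first characteristic function. In the helicoid formula, $\tan^{-1}\big(\frac{y+\gamma}{x+\beta}\big)$ denotes a smooth branch on $\Omega$ of the polar angle about the point $(-\beta,-\gamma)$ (which does not belong to $\Omega$). *)

theory Defs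
  imports "HOL-Analysis.Analysis"
begin
text \<open>Meant for open \<open>S\<close> in a finite-dimensional space, where this is the class \<open>C\<^sup>n\<close>;
  on a general \<open>S\<close> it would ask for derivatives in a full neighbourhood of each point.\<close>

primrec Ck_on :: "nat \<Rightarrow> 'a::real_normed_vector set \<Rightarrow> ('a \<Rightarrow> 'b::real_normed_vector) \<Rightarrow> bool" where
  "Ck_on 0 S f \<longleftrightarrow> continuous_on S f"
| "Ck_on (Suc n) S f \<longleftrightarrow>
     (\<forall>x\<in>S. f differentiable (at x)) \<and> (\<forall>v. Ck_on n S (\<lambda>x. frechet_derivative f (at x) v))"

definition smooth_on :: "'a::real_normed_vector set \<Rightarrow> ('a \<Rightarrow> 'b::real_normed_vector) \<Rightarrow> bool" where
  "smooth_on S f \<longleftrightarrow> (\<forall>n. Ck_on n S f)"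

definition partial_x :: "(real \<times> real \<Rightarrow> real) \<Rightarrow> real \<times> real \<Rightarrow> real" where
  "partial_x f = (\<lambda>(x, y). deriv (\<lambda>t. f (t, y)) x)"

definition partial_y :: "(real \<times> real \<Rightarrow> real) \<Rightarrow> real \<times> real \<Rightarrow> real" where
  "partial_y f = (\<lambda>(x, y). deriv (\<lambda>t. f (x, t)) y)"

definition grad :: "(real \<times> real \<Rightarrow> real) \<Rightarrow> real \<times> real \<Rightarrow> real \<times> real" where
  "grad f p = (partial_x f p, partial_y f p)"

definition minimal_graph_surface :: "(real \<times> real) set \<Rightarrow> (real \<times> real \<Rightarrow> real) \<Rightarrow> bool" where
  "minimal_graph_surface \<Omega> f \<longleftrightarrow>
     open \<Omega> \<and> connected \<Omega> \<and> smooth_on \<Omega> f \<and>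
     (\<forall>p\<in>\<Omega>. (1 + (partial_y f p)\<^sup>2) * partial_x (partial_x f) p
            - 2 * partial_y (partial_x f) p * partial_x f p * partial_y f p
            + (1 + (partial_x f p)\<^sup>2) * partial_y (partial_y f) p = 0)"

definition minimal_graph_transformation ::
    "(real \<times> real) set \<Rightarrow> (real \<times> real \<Rightarrow> real) \<Rightarrow> real set \<Rightarrow> (real \<Rightarrow> real) \<Rightarrow> bool" where
  "minimal_graph_transformation \<Omega> f U g \<longleftrightarrow>
     open U \<and> smooth_on U g \<and> f ` \<Omega> \<subseteq> U \<and> minimal_graph_surface \<Omega> (g \<circ> f)"

definition first_characteristic :: "(real \<Rightarrow> real) \<Rightarrow> real \<Rightarrow> real" where
  "first_characteristic g t = deriv (deriv g) t / ((deriv g t) ^ 3 - deriv g t)"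

definition is_plane :: "(real \<times> real) set \<Rightarrow> (real \<times> real \<Rightarrow> real) \<Rightarrow> bool" where
  "is_plane \<Omega> f \<longleftrightarrow> (\<exists>\<alpha> \<beta> \<gamma>. \<forall>(x, y)\<in>\<Omega>. f (x, y) = \<alpha> * x + \<beta> * y + \<gamma>)"

definition polar_angle_branch ::
    "(real \<times> real) set \<Rightarrow> real \<times> real \<Rightarrow> (real \<times> real \<Rightarrow> real) \<Rightarrow> bool" where
  "polar_angle_branch \<Omega> c \<theta> \<longleftrightarrow>
     c \<notin> \<Omega> \<and> smooth_on \<Omega> \<theta> \<and>
     (\<forall>p\<in>\<Omega>. p - c = norm (p - c) *\<^sub>R (cos (\<theta> p), sin (\<theta> p)))"

text \<open>The branch \<open>\<theta>\<close> renders \<open>arctan ((y + \<gamma>) / (x + \<beta>))\<close>; literally using \<open>arctan\<close> would take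
  the wrong value, and in general jump, on the line \<open>x = - \<beta>\<close>.\<close>

definition is_helicoid :: "(real \<times> real) set \<Rightarrow> (real \<times> real \<Rightarrow> real) \<Rightarrow> bool" where
  "is_helicoid \<Omega> f \<longleftrightarrow>
     (\<exists>\<alpha> \<beta> \<gamma> \<delta> \<theta>. \<alpha> \<noteq> 0 \<and> polar_angle_branch \<Omega> (- \<beta>, - \<gamma>) \<theta> \<and>
        (\<forall>(x, y)\<in>\<Omega>. f (x, y) = - (2 / \<alpha>) * \<theta> (x, y) + \<delta>))"

end

theory Submission
  imports Defs "HOL-Complex_Analysis.Cauchy_Integral_Formula"
begin

text \<open>Since \<open>g'' = 0\<close> on the interval \<open>f(\<Omega>)\<close>, there \<open>g t = a t + b\<close> with \<open>a\<^sup>3 \<noteq> a\<close>.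
  Comparing the minimal surface equations of \<open>f\<close> and \<open>a f + b\<close> separates their linear and cubic
  parts: \<open>f\<close> is harmonic and its level curves are straight. For the holomorphic function
  \<open>F = f\<^sub>x - i f\<^sub>y\<close> the second condition reads \<open>Re ((1/F)') = 0\<close>, so \<open>(1/F)'\<close> is an imaginary
  constant \<open>i k\<close> and \<open>1/F = i k z + c\<close>. If \<open>k = 0\<close> then \<open>f\<close> is affine. Otherwise \<open>F\<close> has
  its pole at a point \<open>z\<^sub>0\<close> outside \<open>\<Omega>\<close>, and \<open>k f\<close> is, up to a constant, a polar angle about
  \<open>z\<^sub>0\<close>: the unit vector \<open>exp (- i k f) (z - z\<^sub>0) / |z - z\<^sub>0|\<close> is constant.\<close>

section \<open>Smooth functions and partial derivatives\<close>

text \<open>Openness is what makes this work: the derivative at a point of \<open>S\<close> depends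
  only on values near it, so \<open>f\<close> and \<open>g\<close> have the same derivative on
  \<open>S\<close> and the induction passes to it.\<close>

lemma Ck_on_cong:
  assumes "open S" "\<And>x. x \<in> S \<Longrightarrow> f x = g x" "Ck_on n S f"
  shows "Ck_on n S g"
  using assms(2,3)
proof (induction n arbitrary: f g)
  case 0
  then show ?case by (auto cong: continuous_on_cong)
next
  case (Suc n)
  have D: "f differentiable (at x)" if "x \<in> S" for x
    using Suc.prems that by simp
  have "g differentiable (at x)" if "x \<in> S" for x
    using D[OF that] has_derivative_transform_within_open[OF _ \<open>open S\<close> that] Suc.prems(1)
    unfolding differentiable_def by blast
  moreover have "frechet_derivative f (at x) = frechet_derivative g (at x)" if "x \<in> S" for x
    using frechet_derivative_transform_within_open[OF D \<open>open S\<close> that] that Suc.prems(1) by blast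
  ultimately show ?case
    using Suc.IH[of "\<lambda>x. frechet_derivative f (at x) _" "\<lambda>x. frechet_derivative g (at x) _"] Suc.prems
    by auto
qed

text \<open>The constant \<open>c\<close> is generalized in the induction because differentiation
  turns it into 0; hence the term \<open>+ 0\<close> in the step, which keeps the shape of the
  induction hypothesis.\<close>

lemma Ck_on_affine:
  fixes f :: "'a::real_normed_vector \<Rightarrow> real"
  assumes "open S" "Ck_on n S f"
  shows "Ck_on n S (\<lambda>x. k * f x + c)"
  using assms(2)
proof (induction n arbitrary: f c)
  case 0
  then show ?case by (auto intro!: continuous_intros)
next
  case (Suc n)
  have D: "((\<lambda>x. k * f x + c) has_derivative (\<lambda>v. k * frechet_derivative f (at x) v)) (at x)"
    if "x \<in> S" for x
  proof -
    have "(f has_derivative frechet_derivative f (at x)) (at x)"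
      using Suc.prems that frechet_derivative_works by auto
    then show ?thesis by (auto intro!: derivative_eq_intros)
  qed
  have "Ck_on n S (\<lambda>x. frechet_derivative (\<lambda>x. k * f x + c) (at x) v)" for v
  proof (rule Ck_on_cong[OF \<open>open S\<close>])
    have "Ck_on n S (\<lambda>x. frechet_derivative f (at x) v)"
      using Suc.prems by simp
    then show "Ck_on n S (\<lambda>x. k * frechet_derivative f (at x) v + 0)"
      by (rule Suc.IH)
    show "k * frechet_derivative f (at x) v + 0 = frechet_derivative (\<lambda>x. k * f x + c) (at x) v"
      if "x \<in> S" for x
      using frechet_derivative_at[OF D[OF that]] by (metis add_0_right)
  qed
  moreover have "(\<lambda>x. k * f x + c) differentiable (at x)" if "x \<in> S" for x
    using D[OF that] unfolding differentiable_def by blast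
  ultimately show ?case by simp
qed

lemma smooth_on_affine:
  fixes f :: "'a::real_normed_vector \<Rightarrow> real"
  assumes "open S" "smooth_on S f"
  shows "smooth_on S (\<lambda>x. k * f x + c)"
  using assms Ck_on_affine unfolding smooth_on_def by blast

lemma smooth_on_cong:
  assumes "open S" "\<And>x. x \<in> S \<Longrightarrow> f x = g x" "smooth_on S f"
  shows "smooth_on S g"
  using assms Ck_on_cong unfolding smooth_on_def by blast

lemma smooth_on_has_derivative:
  assumes "smooth_on S f" "x \<in> S"
  shows "(f has_derivative frechet_derivative f (at x)) (at x)"
proof -
  have "Ck_on (Suc 0) S f" using assms(1) unfolding smooth_on_def by blast
  then show ?thesis using assms(2) frechet_derivative_works by auto
qed

lemma smooth_on_frechet_derivative:
  assumes "smooth_on S f"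
  shows "smooth_on S (\<lambda>x. frechet_derivative f (at x) v)"
  unfolding smooth_on_def
proof
  fix n
  have "Ck_on (Suc n) S f" using assms unfolding smooth_on_def by blast
  then show "Ck_on n S (\<lambda>x. frechet_derivative f (at x) v)" by simp
qed

lemma smooth_on_imp_continuous_on: "smooth_on S f \<Longrightarrow> continuous_on S f"
  unfolding smooth_on_def by (metis Ck_on.simps(1))

section \<open>Partial derivatives and the total derivative\<close>

lemma has_derivative_partial_x:
  assumes "(f has_derivative D) (at p)"
  shows "((\<lambda>t. f (t, snd p)) has_real_derivative D (1, 0)) (at (fst p))"
proof -
  have "((\<lambda>t. (t, snd p)) has_derivative (\<lambda>t. (t, 0))) (at (fst p))"
    by (auto intro!: derivative_eq_intros)
  then have "((\<lambda>t. f (t, snd p)) has_derivative (\<lambda>t. D (t, 0))) (at (fst p))"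
    by (rule has_derivative_compose) (use assms in simp)
  moreover have "(\<lambda>t. D (t, 0)) = (*) (D (1, 0))"
  proof
    show "D (t, 0) = D (1, 0) * t" for t
      using linear_scale[OF has_derivative_linear[OF assms], of t "(1, 0)"] by (simp add: mult.commute)
  qed
  ultimately show ?thesis
    by (simp add: has_field_derivative_def)
qed

lemma has_derivative_partial_y:
  assumes "(f has_derivative D) (at p)"
  shows "((\<lambda>t. f (fst p, t)) has_real_derivative D (0, 1)) (at (snd p))"
proof -
  have "((\<lambda>t. (fst p, t)) has_derivative (\<lambda>t. (0, t))) (at (snd p))"
    by (auto intro!: derivative_eq_intros)
  then have "((\<lambda>t. f (fst p, t)) has_derivative (\<lambda>t. D (0, t))) (at (snd p))"
    by (rule has_derivative_compose) (use assms in simp)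
  moreover have "(\<lambda>t. D (0, t)) = (*) (D (0, 1))"
  proof
    show "D (0, t) = D (0, 1) * t" for t
      using linear_scale[OF has_derivative_linear[OF assms], of t "(0, 1)"] by (simp add: mult.commute)
  qed
  ultimately show ?thesis
    by (simp add: has_field_derivative_def)
qed

lemma partial_x_eq: "(f has_derivative D) (at p) \<Longrightarrow> partial_x f p = D (1, 0)"
  using has_derivative_partial_x[of f D p]
  by (cases p) (simp add: partial_x_def DERIV_imp_deriv)

lemma partial_y_eq: "(f has_derivative D) (at p) \<Longrightarrow> partial_y f p = D (0, 1)"
  using has_derivative_partial_y[of f D p]
  by (cases p) (simp add: partial_y_def DERIV_imp_deriv)

text \<open>The bridge from partials, defined by \<open>deriv\<close> along coordinate lines, to the
  total derivative: it exists by smoothness, and linearity fixes it by its values on the two basis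
  vectors.\<close>

lemma smooth_on_has_partials:
  assumes "smooth_on S f" "p \<in> S"
  shows "(f has_derivative (\<lambda>h. partial_x f p * fst h + partial_y f p * snd h)) (at p)"
proof -
  let ?D = "frechet_derivative f (at p)"
  note D = smooth_on_has_derivative[OF assms]
  have "?D h = partial_x f p * fst h + partial_y f p * snd h" for h
  proof -
    have "?D h = ?D (fst h *\<^sub>R (1, 0) + snd h *\<^sub>R (0, 1))" by simp
    also have "\<dots> = fst h *\<^sub>R ?D (1, 0) + snd h *\<^sub>R ?D (0, 1)"
      by (simp only: linear_add[OF has_derivative_linear[OF D]] linear_scale[OF has_derivative_linear[OF D]])
    finally show ?thesis by (simp add: partial_x_eq[OF D] partial_y_eq[OF D])
  qed
  then have "?D = (\<lambda>h. partial_x f p * fst h + partial_y f p * snd h)" by (rule ext)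
  with D show ?thesis by argo
qed

lemma smooth_on_partial_x:
  assumes "open S" "smooth_on S f" shows "smooth_on S (partial_x f)"
  by (rule smooth_on_cong[OF assms(1) _ smooth_on_frechet_derivative[OF assms(2), of "(1, 0)"]])
    (simp add: partial_x_eq[OF smooth_on_has_derivative[OF assms(2)]])

lemma smooth_on_partial_y:
  assumes "open S" "smooth_on S f" shows "smooth_on S (partial_y f)"
  by (rule smooth_on_cong[OF assms(1) _ smooth_on_frechet_derivative[OF assms(2), of "(0, 1)"]])
    (simp add: partial_y_eq[OF smooth_on_has_derivative[OF assms(2)]])

section \<open>Symmetry of the second partial derivatives\<close>

text \<open>The mean value theorem is used twice: in the first variable on the increment of
  \<open>f\<close> from \<open>y\<close> to \<open>y + h\<close>, then in the second variable on
  \<open>fx\<close>.\<close>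

lemma second_difference_eq:
  fixes f :: "real \<times> real \<Rightarrow> real"
  assumes h: "0 < h" and sub: "{x..x+h} \<times> {y..y+h} \<subseteq> S"
    and fx: "\<And>s t. (s, t) \<in> S \<Longrightarrow> ((\<lambda>s. f (s, t)) has_real_derivative fx (s, t)) (at s)"
    and fxy: "\<And>s t. (s, t) \<in> S \<Longrightarrow> ((\<lambda>t. fx (s, t)) has_real_derivative fxy (s, t)) (at t)"
  obtains s t where "x < s" "s < x + h" "y < t" "t < y + h"
    "f (x+h, y+h) - f (x+h, y) - f (x, y+h) + f (x, y) = h * h * fxy (s, t)"
proof -
  have "\<exists>s>x. s < x + h \<and> (f (x+h, y+h) - f (x+h, y)) - (f (x, y+h) - f (x, y))
      = (x + h - x) * (fx (s, y+h) - fx (s, y))"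
    using h sub by (intro MVT2[where f = "\<lambda>s. f (s, y+h) - f (s, y)"])
      (auto intro!: DERIV_diff fx)
  then obtain s where s: "x < s" "s < x + h"
    "(f (x+h, y+h) - f (x+h, y)) - (f (x, y+h) - f (x, y)) = h * (fx (s, y+h) - fx (s, y))"
    by auto
  have "\<exists>t>y. t < y + h \<and> fx (s, y+h) - fx (s, y) = (y + h - y) * fxy (s, t)"
    using h sub s by (intro MVT2) (auto intro!: fxy)
  then obtain t where "y < t" "t < y + h" "fx (s, y+h) - fx (s, y) = h * fxy (s, t)"
    by auto
  with s show thesis by (intro that[of s t]) (auto simp: algebra_simps)
qed

text \<open>The second difference over a square does not change when the variables trade roles, so
  \<open>fxy\<close> and \<open>fyx\<close> take a common value at two points of each small square.
  Continuity carries the equality to the corner.\<close>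

lemma mixed_partials_eq:
  fixes f :: "real \<times> real \<Rightarrow> real"
  assumes S: "open S" "(x, y) \<in> S"
    and fx: "\<And>s t. (s, t) \<in> S \<Longrightarrow> ((\<lambda>s. f (s, t)) has_real_derivative fx (s, t)) (at s)"
    and fxy: "\<And>s t. (s, t) \<in> S \<Longrightarrow> ((\<lambda>t. fx (s, t)) has_real_derivative fxy (s, t)) (at t)"
    and fy: "\<And>s t. (s, t) \<in> S \<Longrightarrow> ((\<lambda>t. f (s, t)) has_real_derivative fy (s, t)) (at t)"
    and fyx: "\<And>s t. (s, t) \<in> S \<Longrightarrow> ((\<lambda>s. fy (s, t)) has_real_derivative fyx (s, t)) (at s)"
    and cont: "continuous_on S fxy" "continuous_on S fyx"
  shows "fxy (x, y) = fyx (x, y)"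
proof (rule ccontr)
  assume neq: "fxy (x, y) \<noteq> fyx (x, y)"
  \<comment> \<open>Half the gap: numbers within \<open>e\<close> of the two distinct values cannot
    coincide.\<close>
  define e where "e = \<bar>fxy (x, y) - fyx (x, y)\<bar> / 2"
  have e: "e > 0" using neq by (simp add: e_def)
  have "isCont fxy (x, y)" "isCont fyx (x, y)"
    using cont S continuous_on_eq_continuous_at by blast+
  then obtain d1 d2 where d: "d1 > 0" "\<And>q. dist q (x, y) < d1 \<Longrightarrow> dist (fxy q) (fxy (x, y)) < e"
    "d2 > 0" "\<And>q. dist q (x, y) < d2 \<Longrightarrow> dist (fyx q) (fyx (x, y)) < e"
    using e unfolding continuous_at_eps_delta by metis
  obtain d3 where d3: "d3 > 0" "ball (x, y) d3 \<subseteq> S"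
    using S open_contains_ball by metis
  \<comment> \<open>A point of the square of side \<open>h\<close> is at distance at most
    \<open>2 * h < 3 * h\<close> from the corner, so a third of the smallest radius keeps the square
    inside all three balls.\<close>
  define h where "h = min d1 (min d2 d3) / 3"
  have h: "h > 0" "3 * h \<le> d1" "3 * h \<le> d2" "3 * h \<le> d3"
    using d d3 by (auto simp: h_def)
  have near: "dist (s, t) (x, y) < 3 * h" if "x \<le> s" "s \<le> x + h" "y \<le> t" "t \<le> y + h" for s t
  proof -
    have "dist (s, t) (x, y) \<le> \<bar>s - x\<bar> + \<bar>t - y\<bar>"
      unfolding dist_Pair_Pair dist_real_def by (rule sqrt_sum_squares_le_sum) auto
    with that h show ?thesis by auto
  qed
  have sub: "{x..x+h} \<times> {y..y+h} \<subseteq> S"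
  proof safe
    fix s t assume "s \<in> {x..x+h}" "t \<in> {y..y+h}"
    with near[of s t] h d3 show "(s, t) \<in> S" by (auto simp: dist_commute subset_iff)
  qed
  obtain s t where 1: "x < s" "s < x + h" "y < t" "t < y + h"
    "f (x+h, y+h) - f (x+h, y) - f (x, y+h) + f (x, y) = h * h * fxy (s, t)"
    using second_difference_eq[OF h(1) sub fx fxy] by metis
  \<comment> \<open>The same lemma is applied to \<open>f\<close> with its arguments swapped, on the
    reflected set.\<close>
  have sub': "{y..y+h} \<times> {x..x+h} \<subseteq> {(t, s). (s, t) \<in> S}" using sub by auto
  obtain t' s' where 2: "y < t'" "t' < y + h" "x < s'" "s' < x + h"
    "f (x+h, y+h) - f (x, y+h) - f (x+h, y) + f (x, y) = h * h * fyx (s', t')"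
    using second_difference_eq[OF h(1) sub', of "\<lambda>(t, s). f (s, t)" "\<lambda>(t, s). fy (s, t)"
      "\<lambda>(t, s). fyx (s, t)"] fy fyx by auto
  have "h * h * fxy (s, t) = h * h * fyx (s', t')" using 1(5) 2(5) by linarith
  then have "fxy (s, t) = fyx (s', t')" using h by simp
  moreover have "dist (fxy (s, t)) (fxy (x, y)) < e"
    using near[of s t] 1 h by (intro d(2)) auto
  moreover have "dist (fyx (s', t')) (fyx (x, y)) < e"
    using near[of s' t'] 2 h by (intro d(4)) auto
  ultimately show False unfolding dist_real_def e_def by (auto simp: abs_if field_simps split: if_splits)
qed

lemma smooth_on_mixed_partials:
  assumes "open S" "smooth_on S f" "p \<in> S"
  shows "partial_y (partial_x f) p = partial_x (partial_y f) p"
proof -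
  note smx = smooth_on_partial_x[OF assms(1)] and smy = smooth_on_partial_y[OF assms(1)]
  have X: "((\<lambda>s. g (s, t)) has_real_derivative partial_x g (s, t)) (at s)"
   and Y: "((\<lambda>t. g (s, t)) has_real_derivative partial_y g (s, t)) (at t)"
    if "smooth_on S g" "(s, t) \<in> S" for g s t
    using has_derivative_partial_x[OF smooth_on_has_partials[OF that]]
      has_derivative_partial_y[OF smooth_on_has_partials[OF that]] by auto
  obtain x y where p: "p = (x, y)" by (cases p)
  show ?thesis unfolding p
    by (rule mixed_partials_eq[OF assms(1) assms(3)[unfolded p] X[OF assms(2)] Y[OF smx[OF assms(2)]]
          Y[OF assms(2)] X[OF smy[OF assms(2)]]])
      (auto intro!: smooth_on_imp_continuous_on smx smy assms)
qed

lemma partials_affine: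
  assumes "open S" "smooth_on S f" "\<And>q. q \<in> S \<Longrightarrow> h q = a * f q + b" "p \<in> S"
  shows "partial_x h p = a * partial_x f p" "partial_y h p = a * partial_y f p"
proof -
  have "((\<lambda>q. a * f q + b) has_derivative
      (\<lambda>v. a * (partial_x f p * fst v + partial_y f p * snd v))) (at p)"
    using smooth_on_has_partials[OF assms(2,4)] by (auto intro!: derivative_eq_intros)
  then have "(h has_derivative (\<lambda>v. a * (partial_x f p * fst v + partial_y f p * snd v))) (at p)"
    using has_derivative_transform_within_open[OF _ assms(1,4)] assms(3) by force
  from partial_x_eq[OF this] partial_y_eq[OF this]
  show "partial_x h p = a * partial_x f p" "partial_y h p = a * partial_y f p" by simp_all
qed

section \<open>Harmonic functions with straight level curves\<close>

lemma gradient_constant_imp_plane: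
  assumes "open S" "connected S" "smooth_on S f"
    and "\<And>p. p \<in> S \<Longrightarrow> partial_x f p = \<alpha>" "\<And>p. p \<in> S \<Longrightarrow> partial_y f p = \<beta>"
  shows "is_plane S f"
proof (cases "S = {}")
  case False
  then obtain q where q: "q \<in> S" by auto
  let ?r = "\<lambda>p. f p - (\<alpha> * fst p + \<beta> * snd p)"
  have D: "(?r has_derivative (\<lambda>h. 0)) (at p)" if "p \<in> S" for p
    using smooth_on_has_partials[OF assms(3) that] assms(4,5)[OF that]
    by (auto intro!: derivative_eq_intros)
  have "?r p = ?r q" if "p \<in> S" for p
    by (rule has_derivative_zero_unique_connected[OF assms(1,2) D that q])
  then have "f (x, y) = \<alpha> * x + \<beta> * y + ?r q" if "(x, y) \<in> S" for x y
    using that by fastforce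
  then show ?thesis unfolding is_plane_def by blast
qed (simp add: is_plane_def)

section \<open>Holomorphic functions and the complex gradient\<close>

text \<open>The derivative of \<open>Re H\<close> in direction \<open>h\<close> is
  \<open>Re (H' * h)\<close>. Its vanishing for \<open>h = 1\<close> and \<open>h = \<i>\<close>
  removes the real and the imaginary part of \<open>H'\<close>.\<close>

lemma holomorphic_Re_zero_imp_constant:
  assumes "open S" "connected S" "H holomorphic_on S" "\<And>z. z \<in> S \<Longrightarrow> Re (H z) = 0"
  shows "H constant_on S"
proof -
  have D: "(H has_derivative (\<lambda>h. 0)) (at z within S)" if z: "z \<in> S" for z
  proof -
    have H: "(H has_derivative (\<lambda>h. deriv H z * h)) (at z)"
      using holomorphic_derivI[OF assms(3,1) z] by (simp add: has_field_derivative_def)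
    have "((\<lambda>z. Re (H z)) has_derivative (\<lambda>h. Re (deriv H z * h))) (at z)"
      using H by (rule has_derivative_Re)
    moreover have "((\<lambda>z. Re (H z)) has_derivative (\<lambda>h. 0)) (at z)"
      by (rule has_derivative_transform_within_open[OF has_derivative_const[of 0] assms(1) z])
        (simp add: assms(4))
    ultimately have "(\<lambda>h. Re (deriv H z * h)) = (\<lambda>h. 0)"
      by (rule has_derivative_unique)
    from fun_cong[OF this, of 1] fun_cong[OF this, of \<i>] have "deriv H z = 0"
      by (simp add: complex_eq_iff)
    with H show ?thesis
      by (simp add: has_derivative_at_withinI)
  qed
  then show ?thesis
    using has_derivative_zero_connected_constant_on[OF assms(2,1) finite.emptyI
      holomorphic_on_imp_continuous_on[OF assms(3)]] by blast
qed

text \<open>The expression in \<open>Re0\<close> is minus the derivative of \<open>1/F\<close>. This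
  derivative is holomorphic with zero real part, hence an imaginary constant, and \<open>1/F\<close>
  is recovered by integrating it.\<close>

lemma inverse_affine_of_Re_zero:
  assumes S: "open S" "connected S" and F: "F holomorphic_on S" "\<And>z. z \<in> S \<Longrightarrow> F z \<noteq> 0"
    and Re0: "\<And>z. z \<in> S \<Longrightarrow> Re (deriv F z / (F z)\<^sup>2) = 0"
  obtains k c where "\<And>z. z \<in> S \<Longrightarrow> inverse (F z) = \<i> * of_real k * z + c"
proof -
  define G where "G = (\<lambda>z. inverse (F z))"
  have G: "(G has_field_derivative - (deriv F z / (F z)\<^sup>2)) (at z)" if "z \<in> S" for z
    unfolding G_def using holomorphic_derivI[OF F(1) S(1) that] F(2)[OF that]
    by (auto intro!: derivative_eq_intros simp: power2_eq_square field_simps)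
  have hG: "G holomorphic_on S"
    unfolding G_def using F by (intro holomorphic_intros) auto
  have "deriv G constant_on S"
    using S holomorphic_deriv[OF hG S(1)]
    by (rule holomorphic_Re_zero_imp_constant) (use DERIV_imp_deriv[OF G] Re0 in simp)
  then obtain m where m: "\<And>z. z \<in> S \<Longrightarrow> deriv G z = m"
    unfolding constant_on_def by auto
  show thesis
  proof (cases "S = {}")
    case False
    then obtain w where w: "w \<in> S" by auto
    have "Re m = 0" using m[OF w] DERIV_imp_deriv[OF G[OF w]] Re0[OF w] by auto
    then obtain k where k: "m = \<i> * of_real k" by (metis complex_eq add_0 of_real_0)
    have D: "((\<lambda>z. G z - m * z) has_derivative (\<lambda>h. 0)) (at z)" if "z \<in> S" for z
      using holomorphic_derivI[OF hG S(1) that] m[OF that]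
      unfolding has_field_derivative_def by (auto intro!: derivative_eq_intros)
    have "G z - m * z = G w - m * w" if "z \<in> S" for z
      by (rule has_derivative_zero_unique_connected[OF S D that w])
    then have "inverse (F z) = \<i> * of_real k * z + (G w - m * w)" if "z \<in> S" for z
      using that unfolding k G_def by (simp add: algebra_simps)
    then show thesis by (rule that)
  qed (use that in auto)
qed

text \<open>These are the Cauchy-Riemann equations for \<open>f_x - i f_y\<close>: one is the
  Laplace equation, the other the symmetry of the mixed partials.\<close>

lemma complex_gradient_has_field_derivative:
  assumes "open S" "smooth_on S f" "p \<in> S"
    and "partial_x (partial_x f) p + partial_y (partial_y f) p = 0"
  shows "((\<lambda>z. Complex (partial_x f (Re z, Im z)) (- partial_y f (Re z, Im z)))
    has_field_derivative Complex (partial_x (partial_x f) p) (- partial_y (partial_x f) p))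
    (at (Complex (fst p) (snd p)))"
proof -
  let ?z = "Complex (fst p) (snd p)"
  have comp: "((\<lambda>z. g (Re z, Im z)) has_derivative
      (\<lambda>h. partial_x g p * Re h + partial_y g p * Im h)) (at ?z)" if "smooth_on S g" for g
  proof -
    have "((\<lambda>z. (Re z, Im z)) has_derivative (\<lambda>h. (Re h, Im h))) (at ?z)"
      by (auto intro!: derivative_eq_intros)
    moreover have "(g has_derivative (\<lambda>h. partial_x g p * fst h + partial_y g p * snd h))
        (at (Re ?z, Im ?z))"
      using smooth_on_has_partials[OF that assms(3)] by simp
    ultimately show ?thesis
      using has_derivative_compose[of "\<lambda>z. (Re z, Im z)"] by fastforce
  qed
  let ?X = "partial_x f" and ?Y = "partial_y f"
  note X = comp[OF smooth_on_partial_x[OF assms(1,2)]]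
    and Y = comp[OF smooth_on_partial_y[OF assms(1,2)]]
  have "((\<lambda>z. of_real (?X (Re z, Im z)) - \<i> * of_real (?Y (Re z, Im z))) has_derivative
     (\<lambda>h. of_real (partial_x ?X p * Re h + partial_y ?X p * Im h)
       - \<i> * of_real (partial_x ?Y p * Re h + partial_y ?Y p * Im h))) (at ?z)"
    by (intro has_derivative_diff has_derivative_of_real has_derivative_mult_right X Y)
  moreover have "(\<lambda>h. of_real (partial_x ?X p * Re h + partial_y ?X p * Im h)
       - \<i> * of_real (partial_x ?Y p * Re h + partial_y ?Y p * Im h))
     = (*) (Complex (partial_x ?X p) (- partial_y ?X p))"
  proof
    fix h
    have "partial_y ?Y p = - partial_x ?X p" "partial_x ?Y p = partial_y ?X p"
      using assms(4) smooth_on_mixed_partials[OF assms(1-3)] by simp_all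
    then show "of_real (partial_x ?X p * Re h + partial_y ?X p * Im h)
       - \<i> * of_real (partial_x ?Y p * Re h + partial_y ?Y p * Im h)
       = Complex (partial_x ?X p) (- partial_y ?X p) * h"
      by (simp add: complex_eq_iff algebra_simps)
  qed
  moreover have "(\<lambda>z. of_real (?X (Re z, Im z)) - \<i> * of_real (?Y (Re z, Im z)))
     = (\<lambda>z. Complex (?X (Re z, Im z)) (- ?Y (Re z, Im z)))"
    by (simp add: fun_eq_iff complex_eq_iff)
  ultimately show ?thesis unfolding has_field_derivative_def by metis
qed

section \<open>Recognising a helicoid from its gradient\<close>

text \<open>Used at \<open>t = 0\<close> and \<open>t = pi / 2\<close>, which give the two coordinates of the unit vector
  \<open>exp (- i k f) (z - z\<^sub>0) / |z - z\<^sub>0|\<close>, where \<open>z\<^sub>0 = a + i b\<close>.\<close>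

lemma radial_ratio_constant:
  fixes a b k t :: real
  assumes S: "open S" "connected S" "smooth_on S f" "p \<in> S" "q \<in> S"
    and ang: "\<And>x y. (x, y) \<in> S \<Longrightarrow> k * ((x - a) * partial_y f (x, y) - (y - b) * partial_x f (x, y)) = 1"
    and rad: "\<And>x y. (x, y) \<in> S \<Longrightarrow> (x - a) * partial_x f (x, y) + (y - b) * partial_y f (x, y) = 0"
  defines "\<rho> \<equiv> \<lambda>p. ((fst p - a) * cos (k * f p + t) + (snd p - b) * sin (k * f p + t))
      / sqrt ((fst p - a)\<^sup>2 + (snd p - b)\<^sup>2)"
  shows "\<rho> p = \<rho> q"
proof -
  have D: "(\<rho> has_derivative (\<lambda>h. 0)) (at p)" if p: "p \<in> S" for p
  proof -
    define X Y C D R where "X = fst p - a" and "Y = snd p - b" and "C = cos (k * f p + t)"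
      and "D = sin (k * f p + t)" and "R = X\<^sup>2 + Y\<^sup>2"
    let ?u = "partial_x f p" and ?v = "partial_y f p"
    have 1: "k * (X * ?v - Y * ?u) = 1" and 2: "X * ?u + Y * ?v = 0"
      using ang[of "fst p" "snd p"] rad[of "fst p" "snd p"] p by (auto simp: X_def Y_def)
    have "X \<noteq> 0 \<or> Y \<noteq> 0" using 1 by auto
    then have R: "R > 0" by (simp add: R_def sum_power2_gt_zero_iff)
    \<comment> \<open>The two linear equations are solved for the gradient: \<open>k\<close> times
      it is \<open>(- Y, X) / R\<close>, the gradient of the polar angle about
      \<open>(a, b)\<close>.\<close>
    have ku: "k * ?u * R = - Y" and kv: "k * ?v * R = X"
      using 1 2 unfolding R_def power2_eq_square by algebra+
    have dP: "((\<lambda>p. (fst p - a) * cos (k * f p + t) + (snd p - b) * sin (k * f p + t)) has_derivative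
        (\<lambda>h. fst h * C + snd h * D + (Y * C - X * D) * (k * (?u * fst h + ?v * snd h)))) (at p)"
      using smooth_on_has_partials[OF S(3) p] unfolding X_def Y_def C_def D_def
      by (auto intro!: derivative_eq_intros simp: algebra_simps)
    have dr: "((\<lambda>p. sqrt ((fst p - a)\<^sup>2 + (snd p - b)\<^sup>2)) has_derivative
        (\<lambda>h. (X * fst h + Y * snd h) / sqrt R)) (at p)"
    proof -
      have sq: "((\<lambda>p. (fst p - a)\<^sup>2 + (snd p - b)\<^sup>2) has_derivative
          (\<lambda>h. 2 * (X * fst h + Y * snd h))) (at p)"
        unfolding X_def Y_def by (auto intro!: derivative_eq_intros simp: algebra_simps)
      have "((\<lambda>p. sqrt ((fst p - a)\<^sup>2 + (snd p - b)\<^sup>2)) has_derivative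
          (\<lambda>h. 2 * (X * fst h + Y * snd h) * (inverse (sqrt R) / 2))) (at p)"
        using has_derivative_real_sqrt[OF _ sq[unfolded X_def Y_def], OF R[unfolded R_def X_def Y_def]]
        unfolding R_def X_def Y_def .
      then show ?thesis
        by (rule has_derivative_eq_rhs) (use R in \<open>simp add: field_simps fun_eq_iff\<close>)
    qed
    \<comment> \<open>The numerator \<open>N\<close> and the radius \<open>r = sqrt R\<close>
      satisfy \<open>N' * r = N * r'\<close>, here multiplied by \<open>r\<close>. So the quotient
      rule gives derivative 0 for \<open>N / r\<close>, in the form stated by
      \<open>zero\<close>.\<close>
    have key: "(fst h * C + snd h * D + (Y * C - X * D) * (k * (?u * fst h + ?v * snd h))) * R
        = (X * C + Y * D) * (X * fst h + Y * snd h)" for h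
    proof -
      have "(fst h * C + snd h * D + (Y * C - X * D) * (k * (?u * fst h + ?v * snd h))) * R
        = (fst h * C + snd h * D) * R
          + (Y * C - X * D) * ((k * ?u * R) * fst h + (k * ?v * R) * snd h)"
        by algebra
      also have "\<dots> = (X * C + Y * D) * (X * fst h + Y * snd h)"
        unfolding ku kv unfolding R_def by algebra
      finally show ?thesis .
    qed
    have zero: "((fst h * C + snd h * D + (Y * C - X * D) * (k * (?u * fst h + ?v * snd h))) * sqrt R
        - (X * C + Y * D) * ((X * fst h + Y * snd h) / sqrt R)) / (sqrt R * sqrt R) = 0" for h
    proof -
      let ?A = "fst h * C + snd h * D + (Y * C - X * D) * (k * (?u * fst h + ?v * snd h))"
      have "R / sqrt R = sqrt R" using R by (simp add: real_div_sqrt)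
      then have eq: "?A * sqrt R = ?A * R / sqrt R" by (metis times_divide_eq_right)
      show ?thesis unfolding eq key by simp
    qed
    have "sqrt ((fst p - a)\<^sup>2 + (snd p - b)\<^sup>2) \<noteq> 0"
      using R unfolding R_def X_def Y_def by (metis less_irrefl real_sqrt_eq_zero_cancel_iff)
    from has_derivative_divide'[OF dP dr this, folded X_def Y_def, folded C_def D_def R_def]
    show ?thesis unfolding \<rho>_def zero .
  qed
  show ?thesis
    by (rule has_derivative_zero_unique_connected[OF S(1,2) D S(4,5)])
qed

text \<open>In polar coordinates about \<open>(a, b)\<close>, \<open>rad\<close> says that
  \<open>f\<close> has no radial derivative and \<open>ang\<close> that its angular derivative is
  \<open>1 / k\<close>. Globally, \<open>A\<close> and \<open>B\<close> are the coordinates of the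
  unit vector from \<open>(a, b)\<close> to \<open>p\<close>, rotated by \<open>- k * f p\<close>;
  they are constant, and their angle \<open>\<phi>\<close> is the offset between
  \<open>k * f\<close> and a branch of the polar angle.\<close>

lemma gradient_circular_imp_helicoid:
  assumes S: "open S" "connected S" "smooth_on S f" "p0 \<in> S"
    and ang: "\<And>x y. (x, y) \<in> S \<Longrightarrow> k * ((x - a) * partial_y f (x, y) - (y - b) * partial_x f (x, y)) = 1"
    and rad: "\<And>x y. (x, y) \<in> S \<Longrightarrow> (x - a) * partial_x f (x, y) + (y - b) * partial_y f (x, y) = 0"
  shows "is_helicoid S f"
proof -
  define r where "r = (\<lambda>p. sqrt ((fst p - a)\<^sup>2 + (snd p - b)\<^sup>2))"
  define A where "A = (\<lambda>p. ((fst p - a) * cos (k * f p) + (snd p - b) * sin (k * f p)) / r p)"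
  define B where "B = (\<lambda>p. ((snd p - b) * cos (k * f p) - (fst p - a) * sin (k * f p)) / r p)"
  \<comment> \<open>For \<open>k = 0\<close>, or at the point \<open>(a, b)\<close>,
    \<open>ang\<close> would read \<open>0 = 1\<close>.\<close>
  have k: "k \<noteq> 0" using ang[of "fst p0" "snd p0"] S(4) by auto
  have notin: "(a, b) \<notin> S" using ang[of a b] by auto
  have r: "r p > 0" if "p \<in> S" for p
    using that notin unfolding r_def by (cases p) (auto simp: sum_power2_gt_zero_iff)
  have A: "A p = A p0" if "p \<in> S" for p
    using radial_ratio_constant[OF S(1-3) that S(4) ang rad, of 0] by (simp add: A_def r_def)
  have B: "B p = B p0" if "p \<in> S" for p
    using radial_ratio_constant[OF S(1-3) that S(4) ang rad, of "pi / 2"]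
    by (simp add: B_def r_def cos_add sin_add algebra_simps)
  have AB: "(A p0)\<^sup>2 + (B p0)\<^sup>2 = 1"
  proof -
    have "(r p0)\<^sup>2 * ((A p0)\<^sup>2 + (B p0)\<^sup>2) =
        ((fst p0 - a) * cos (k * f p0) + (snd p0 - b) * sin (k * f p0))\<^sup>2
        + ((snd p0 - b) * cos (k * f p0) - (fst p0 - a) * sin (k * f p0))\<^sup>2"
      using r[OF S(4)] unfolding A_def B_def by (simp add: power_divide field_simps)
    also have "\<dots> = ((fst p0 - a)\<^sup>2 + (snd p0 - b)\<^sup>2) * ((cos (k * f p0))\<^sup>2 + (sin (k * f p0))\<^sup>2)"
      by algebra
    also have "\<dots> = (r p0)\<^sup>2" by (simp add: r_def)
    finally show ?thesis using r[OF S(4)] by simp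
  qed
  obtain \<phi> where \<phi>: "A p0 = cos \<phi>" "B p0 = sin \<phi>"
    using sincos_total_2pi[OF AB] by metis
  let ?\<theta> = "\<lambda>p. k * f p + \<phi>"
  have "p - (a, b) = norm (p - (a, b)) *\<^sub>R (cos (?\<theta> p), sin (?\<theta> p))" if p: "p \<in> S" for p
  proof -
    let ?c = "cos (k * f p)" and ?s = "sin (k * f p)"
    have n: "norm (p - (a, b)) = r p"
      by (cases p) (simp add: r_def norm_Pair)
    have P: "(fst p - a) * ?c + (snd p - b) * ?s = r p * cos \<phi>"
     and Q: "(snd p - b) * ?c - (fst p - a) * ?s = r p * sin \<phi>"
    proof -
      have "(fst p - a) * ?c + (snd p - b) * ?s = r p * A p"
        "(snd p - b) * ?c - (fst p - a) * ?s = r p * B p"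
        using r[OF p] by (simp_all add: A_def B_def)
      then show "(fst p - a) * ?c + (snd p - b) * ?s = r p * cos \<phi>"
        "(snd p - b) * ?c - (fst p - a) * ?s = r p * sin \<phi>"
        unfolding A[OF p] B[OF p] \<phi> .
    qed
    have cs: "?c * ?c + ?s * ?s = 1" by (metis sin_cos_squared_add3)
    \<comment> \<open>The addition formulas rotate the constant vector back by
      \<open>k * f p\<close>, and \<open>P\<close> and \<open>Q\<close> turn the result into
      \<open>p - (a, b)\<close>.\<close>
    have "r p * cos (?\<theta> p) = ?c * (r p * cos \<phi>) - ?s * (r p * sin \<phi>)"
      by (simp add: cos_add algebra_simps)
    also have "\<dots> = (fst p - a) * (?c * ?c + ?s * ?s)" unfolding P[symmetric] Q[symmetric] by algebra
    finally have c: "r p * cos (?\<theta> p) = fst p - a" unfolding cs by simp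
    have "r p * sin (?\<theta> p) = ?s * (r p * cos \<phi>) + ?c * (r p * sin \<phi>)"
      by (simp add: sin_add algebra_simps)
    also have "\<dots> = (snd p - b) * (?c * ?c + ?s * ?s)" unfolding P[symmetric] Q[symmetric] by algebra
    finally have s: "r p * sin (?\<theta> p) = snd p - b" unfolding cs by simp
    show ?thesis unfolding n by (rule prod_eqI) (simp_all add: c s)
  qed
  then have "polar_angle_branch S (- (- a), - (- b)) ?\<theta>"
    using notin smooth_on_affine[OF S(1,3)] unfolding polar_angle_branch_def by simp
  \<comment> \<open>The choice \<open>\<alpha> = - 2 * k\<close> turns the factor
    \<open>- (2 / \<alpha>)\<close> into \<open>1 / k\<close>, and
    \<open>\<delta> = - \<phi> / k\<close> cancels the offset of the branch.\<close>
  moreover have "\<forall>(x, y)\<in>S. f (x, y) = - (2 / (- 2 * k)) * ?\<theta> (x, y) + (- \<phi> / k)"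
    using k by (auto simp: field_simps)
  moreover have "- 2 * k \<noteq> 0" using k by simp
  ultimately show ?thesis unfolding is_helicoid_def by blast
qed

text \<open>The left side of \<open>level\<close> is, up to sign and a power of the gradient norm,
  the curvature of the level curves. Passing to the complex plane makes both equations statements
  about one holomorphic function.\<close>

lemma harmonic_straight_levels_imp_plane_or_helicoid:
  assumes S: "open S" "connected S" "smooth_on S f"
    and grad: "\<And>p. p \<in> S \<Longrightarrow> grad f p \<noteq> 0"
    and lap: "\<And>p. p \<in> S \<Longrightarrow> partial_x (partial_x f) p + partial_y (partial_y f) p = 0"
    and level: "\<And>p. p \<in> S \<Longrightarrow> (partial_y f p)\<^sup>2 * partial_x (partial_x f) p
      - 2 * partial_y (partial_x f) p * partial_x f p * partial_y f p
      + (partial_x f p)\<^sup>2 * partial_y (partial_y f) p = 0"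
  shows "is_plane S f \<or> is_helicoid S f"
proof (cases "S = {}")
  case False
  then obtain p0 where p0: "p0 \<in> S" by auto
  define T where "T = {z. (Re z, Im z) \<in> S}"
  define F where "F = (\<lambda>z. Complex (partial_x f (Re z, Im z)) (- partial_y f (Re z, Im z)))"
  have "T = (\<lambda>z. (Re z, Im z)) -` S" by (auto simp: T_def)
  then have T1: "open T"
    using S(1) by (simp add: open_vimage continuous_on_Pair continuous_on_Re continuous_on_Im)
  have "T = (\<lambda>p. Complex (fst p) (snd p)) ` S"
    by (force simp: T_def image_iff complex_eq_iff)
  moreover have "continuous_on S (\<lambda>p. Complex (fst p) (snd p))"
    unfolding Complex_eq by (intro continuous_intros)
  ultimately have T2: "connected T"
    using connected_continuous_image[OF _ S(2)] by metis
  have dF: "(F has_field_derivative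
      Complex (partial_x (partial_x f) (Re z, Im z)) (- partial_y (partial_x f) (Re z, Im z))) (at z)"
    if "z \<in> T" for z
    using complex_gradient_has_field_derivative[OF S(1,3) _ lap, of "(Re z, Im z)"] that
    by (simp add: F_def T_def)
  have hF: "F holomorphic_on T"
    using dF T1 by (auto simp: holomorphic_on_open)
  have F0: "F z \<noteq> 0" if "z \<in> T" for z
    using grad[of "(Re z, Im z)"] that by (auto simp: F_def T_def grad_def complex_eq_iff zero_prod_def)
  have "Re (deriv F z / (F z)\<^sup>2) = 0" if z: "z \<in> T" for z
  proof -
    let ?p = "(Re z, Im z)"
    let ?u = "partial_x f ?p" and ?v = "partial_y f ?p"
      and ?xx = "partial_x (partial_x f) ?p" and ?xy = "partial_y (partial_x f) ?p"
    have p: "?p \<in> S" using z by (simp add: T_def)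
    have "partial_y (partial_y f) ?p = - ?xx" using lap[OF p] by simp
    with level[OF p] have "?xx * (?u\<^sup>2 - ?v\<^sup>2) + 2 * ?xy * ?u * ?v = 0" by algebra
    \<comment> \<open>By \<open>lap\<close>, \<open>level\<close> is the negative of this real part;
      dividing by \<open>(F z)^2\<close> differs from multiplying by its conjugate only by a
      positive factor.\<close>
    moreover have "Re (deriv F z * cnj ((F z)\<^sup>2)) = ?xx * (?u\<^sup>2 - ?v\<^sup>2) + 2 * ?xy * ?u * ?v"
      unfolding DERIV_imp_deriv[OF dF[OF z]] by (simp add: F_def power2_eq_square algebra_simps)
    ultimately show ?thesis by (simp add: complex_div_cnj[of "deriv F z"])
  qed
  then obtain k c where kc: "\<And>z. z \<in> T \<Longrightarrow> inverse (F z) = \<i> * of_real k * z + c"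
    using inverse_affine_of_Re_zero[OF T1 T2 hF F0] by metis
  show ?thesis
  proof (cases "k = 0")
    case True
    have "F z = inverse c" if "z \<in> T" for z
      using arg_cong[OF kc[OF that], of inverse] True by simp
    then have "F (Complex (fst p) (snd p)) = inverse c" if "p \<in> S" for p
      using that by (simp add: T_def)
    then have "partial_x f p = Re (inverse c)" "partial_y f p = - Im (inverse c)" if "p \<in> S" for p
      using that by (auto simp: F_def complex_eq_iff)
    then show ?thesis using gradient_constant_imp_plane[OF S] by blast
  next
    case False
    \<comment> \<open>The pole of \<open>F\<close>, that is the zero \<open>- c / (i k)\<close> of
      \<open>i k z + c\<close>, is the point \<open>a + i b\<close>.\<close>
    define a b where "a = - Im c / k" and "b = Re c / k"
    have eqs: "k * ((x - a) * partial_y f (x, y) - (y - b) * partial_x f (x, y)) = 1"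
      "(x - a) * partial_x f (x, y) + (y - b) * partial_y f (x, y) = 0" if "(x, y) \<in> S" for x y
    proof -
      have z: "Complex x y \<in> T" using that by (simp add: T_def)
      have one: "F (Complex x y) * (\<i> * of_real k * Complex x y + c) = 1"
        unfolding kc[OF z, symmetric] using F0[OF z] by simp
      have ab: "Im c = - a * k" "Re c = b * k" using False by (simp_all add: a_def b_def)
      \<comment> \<open>The equation is now \<open>F * i k (z - (a + i b)) = 1\<close>: its real
        part is the angular equation, its imaginary part \<open>k\<close> times the radial
        one.\<close>
      from one show "k * ((x - a) * partial_y f (x, y) - (y - b) * partial_x f (x, y)) = 1"
        by (simp add: complex_eq_iff F_def ab algebra_simps)
      from one have "k * ((x - a) * partial_x f (x, y) + (y - b) * partial_y f (x, y)) = 0"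
        by (simp add: complex_eq_iff F_def ab algebra_simps)
      with False show "(x - a) * partial_x f (x, y) + (y - b) * partial_y f (x, y) = 0" by simp
    qed
    then show ?thesis using gradient_circular_imp_helicoid[OF S p0] by blast
  qed
qed (simp add: is_plane_def)

section \<open>Affine transformations of minimal graphs\<close>

text \<open>Write the minimal surface equation as \<open>L + Q = 0\<close> with \<open>L\<close> the
  Laplacian and \<open>Q\<close> cubic in \<open>f\<close>. For \<open>a f + b\<close> it reads
  \<open>a L + a^3 Q = 0\<close>, and \<open>a^3 \<noteq> a\<close> forces
  \<open>L = Q = 0\<close>.\<close>

lemma minimal_affine_image_imp_harmonic:
  assumes f: "minimal_graph_surface S f" and h: "minimal_graph_surface S h"
    and eq: "\<And>p. p \<in> S \<Longrightarrow> h p = a * f p + b" and a: "a \<notin> {0, 1, -1}" and p: "p \<in> S"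
  shows "partial_x (partial_x f) p + partial_y (partial_y f) p = 0"
    and "(partial_y f p)\<^sup>2 * partial_x (partial_x f) p
      - 2 * partial_y (partial_x f) p * partial_x f p * partial_y f p
      + (partial_x f p)\<^sup>2 * partial_y (partial_y f) p = 0"
proof -
  have S: "open S" "smooth_on S f" using f unfolding minimal_graph_surface_def by auto
  note P = partials_affine[OF S eq]
  note Px = partials_affine[OF S(1) smooth_on_partial_x[OF S], of "partial_x h" a 0]
  note Py = partials_affine[OF S(1) smooth_on_partial_y[OF S], of "partial_y h" a 0]
  have second: "partial_x (partial_x h) p = a * partial_x (partial_x f) p"
     "partial_y (partial_x h) p = a * partial_y (partial_x f) p"
     "partial_y (partial_y h) p = a * partial_y (partial_y f) p"
    using Px Py P p by simp_all
  define u v xx xy yy where "u = partial_x f p" and "v = partial_y f p"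
    and "xx = partial_x (partial_x f) p" and "xy = partial_y (partial_x f) p"
    and "yy = partial_y (partial_y f) p"
  note defs = u_def[symmetric] v_def[symmetric] xx_def[symmetric] xy_def[symmetric] yy_def[symmetric]
  have 1: "(1 + v\<^sup>2) * xx - 2 * xy * u * v + (1 + u\<^sup>2) * yy = 0"
    using f p unfolding minimal_graph_surface_def defs by (auto simp: defs)
  have 2: "(1 + (a * v)\<^sup>2) * (a * xx) - 2 * (a * xy) * (a * u) * (a * v) + (1 + (a * u)\<^sup>2) * (a * yy) = 0"
    using h p P[OF _ p] second unfolding minimal_graph_surface_def by (auto simp: defs)
  have "a * (1 - a) * (1 + a) * (xx + yy) = 0" using 1 2 by algebra
  moreover have "a \<noteq> 0" "1 - a \<noteq> 0" "1 + a \<noteq> 0" using a by auto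
  ultimately have 3: "xx + yy = 0" by auto
  then show "partial_x (partial_x f) p + partial_y (partial_y f) p = 0" by (simp add: defs)
  have "v\<^sup>2 * xx - 2 * xy * u * v + u\<^sup>2 * yy = 0" using 1 3 by algebra
  then show "(partial_y f p)\<^sup>2 * partial_x (partial_x f) p
      - 2 * partial_y (partial_x f) p * partial_x f p * partial_y f p
      + (partial_x f p)\<^sup>2 * partial_y (partial_y f) p = 0" by (simp add: defs)
qed

section \<open>Functions of one variable with vanishing second derivative\<close>

lemma smooth_on_deriv:
  fixes g :: "real \<Rightarrow> real"
  assumes "open U" "smooth_on U g"
  shows "\<And>t. t \<in> U \<Longrightarrow> (g has_real_derivative deriv g t) (at t)" "smooth_on U (deriv g)"
proof -
  have D: "(g has_real_derivative frechet_derivative g (at t) 1) (at t)" if "t \<in> U" for t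
  proof -
    note E = smooth_on_has_derivative[OF assms(2) that]
    have "frechet_derivative g (at t) = (*) (frechet_derivative g (at t) 1)"
    proof
      show "frechet_derivative g (at t) x = frechet_derivative g (at t) 1 * x" for x
        using linear_scale[OF has_derivative_linear[OF E], of x 1] by (simp add: mult.commute)
    qed
    with E show ?thesis unfolding has_field_derivative_def by argo
  qed
  then show "(g has_real_derivative deriv g t) (at t)" if "t \<in> U" for t
    using DERIV_imp_deriv that by metis
  show "smooth_on U (deriv g)"
    by (rule smooth_on_cong[OF assms(1) _ smooth_on_frechet_derivative[OF assms(2), of 1]])
      (simp add: DERIV_imp_deriv[OF D])
qed

lemma second_deriv_zero_imp_affine:
  fixes g :: "real \<Rightarrow> real"
  assumes "open U" "smooth_on U g" "I \<subseteq> U" "connected I"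
    and "\<And>t. t \<in> I \<Longrightarrow> deriv (deriv g) t = 0"
  obtains a b where "\<And>t. t \<in> I \<Longrightarrow> g t = a * t + b" "\<And>t. t \<in> I \<Longrightarrow> deriv g t = a"
proof -
  note g = smooth_on_deriv[OF assms(1,2)]
  note g' = smooth_on_deriv(1)[OF assms(1) g(2)]
  have conv: "convex I" using assms(4) by (simp add: is_interval_connected_1 flip: is_interval_convex_1)
  have "(deriv g has_real_derivative 0) (at t within I)" if "t \<in> I" for t
    using g'[of t] assms(3,5) that by (auto intro: has_field_derivative_at_within)
  then obtain a where a: "\<And>t. t \<in> I \<Longrightarrow> deriv g t = a"
    using has_field_derivative_zero_constant[OF conv] by metis
  have "((\<lambda>t. g t - a * t) has_real_derivative 0) (at t within I)" if "t \<in> I" for t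
    using g(1)[of t] assms(3) a[OF that] that
    by (auto intro!: derivative_eq_intros intro: has_field_derivative_at_within)
  then obtain b where "\<And>t. t \<in> I \<Longrightarrow> g t - a * t = b"
    using has_field_derivative_zero_constant[OF conv] by metis
  then have "g t = a * t + b" if "t \<in> I" for t using that by (simp add: algebra_simps)
  with a show thesis using that by blast
qed

section \<open>Affine images of planes and helicoids, and the classification\<close>

lemma is_plane_affine:
  assumes "is_plane S f" "\<And>p. p \<in> S \<Longrightarrow> h p = a * f p + b"
  shows "is_plane S h"
proof -
  obtain \<alpha> \<beta> \<gamma> where "\<forall>(x, y)\<in>S. f (x, y) = \<alpha> * x + \<beta> * y + \<gamma>"
    using assms(1) unfolding is_plane_def by blast
  then have "\<forall>(x, y)\<in>S. h (x, y) = (a * \<alpha>) * x + (a * \<beta>) * y + (a * \<gamma> + b)"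
    using assms(2) by (auto simp: algebra_simps)
  then show ?thesis unfolding is_plane_def by blast
qed

text \<open>The same centre and branch serve; only \<open>\<alpha>\<close> becomes
  \<open>\<alpha> / a\<close> and \<open>\<delta>\<close> becomes
  \<open>a * \<delta> + b\<close>.\<close>

lemma is_helicoid_affine:
  assumes "is_helicoid S f" "\<And>p. p \<in> S \<Longrightarrow> h p = a * f p + b" "a \<noteq> 0"
  shows "is_helicoid S h"
proof -
  obtain \<alpha> \<beta> \<gamma> \<delta> \<theta> where \<theta>: "\<alpha> \<noteq> 0" "polar_angle_branch S (- \<beta>, - \<gamma>) \<theta>"
    and "\<forall>(x, y)\<in>S. f (x, y) = - (2 / \<alpha>) * \<theta> (x, y) + \<delta>"
    using assms(1) unfolding is_helicoid_def by blast
  then have "\<forall>(x, y)\<in>S. h (x, y) = - (2 / (\<alpha> / a)) * \<theta> (x, y) + (a * \<delta> + b)"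
    using assms(2,3) by (auto simp: algebra_simps)
  moreover have "\<alpha> / a \<noteq> 0" using \<theta> assms(3) by simp
  ultimately show ?thesis using \<theta>(2) unfolding is_helicoid_def by blast
qed

theorem mainTheorem3:
  fixes \<Omega> :: "(real \<times> real) set" and f :: "real \<times> real \<Rightarrow> real"
    and U :: "real set" and g :: "real \<Rightarrow> real"
  assumes "open \<Omega>" and "connected \<Omega>"
    and "minimal_graph_surface \<Omega> f"
    and "\<And>p. p \<in> \<Omega> \<Longrightarrow> (norm (grad f p))\<^sup>2 \<noteq> 0"
    and "minimal_graph_transformation \<Omega> f U g"
    and "\<And>t. t \<in> U \<Longrightarrow> (deriv g t) ^ 3 - deriv g t \<noteq> 0"
    and "\<And>t. t \<in> f ` \<Omega> \<Longrightarrow> first_characteristic g t = 0"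
  shows "(is_plane \<Omega> f \<or> is_helicoid \<Omega> f)
       \<and> (\<exists>a b. a \<notin> {0, 1, - 1} \<and> (\<forall>t \<in> f ` \<Omega>. g t = a * t + b))
       \<and> (is_plane \<Omega> f \<longrightarrow> is_plane \<Omega> (g \<circ> f))
       \<and> (is_helicoid \<Omega> f \<longrightarrow> is_helicoid \<Omega> (g \<circ> f))"
proof -
  have f: "smooth_on \<Omega> f" using assms(3) unfolding minimal_graph_surface_def by blast
  have g: "open U" "smooth_on U g" "f ` \<Omega> \<subseteq> U" "minimal_graph_surface \<Omega> (g \<circ> f)"
    using assms(5) unfolding minimal_graph_transformation_def by auto
  have "connected (f ` \<Omega>)"
    using smooth_on_imp_continuous_on[OF f] assms(2) by (rule connected_continuous_image)
  \<comment> \<open>The denominator of the characteristic function is nonzero on \<open>U\<close>,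
    so its zeros are those of the numerator; a zero denominator would make the quotient 0 by
    convention.\<close>
  moreover have "deriv (deriv g) t = 0" if "t \<in> f ` \<Omega>" for t
    using assms(6)[of t] assms(7)[OF that] that g(3) unfolding first_characteristic_def by auto
  ultimately obtain a' b where a': "\<And>t. t \<in> f ` \<Omega> \<Longrightarrow> g t = a' * t + b" "\<And>t. t \<in> f ` \<Omega> \<Longrightarrow> deriv g t = a'"
    using second_deriv_zero_imp_affine[OF g(1-3)] by metis
  \<comment> \<open>On an empty domain the slope \<open>a'\<close> is unconstrained, so an arbitrary
    admissible value, 2, replaces it. Otherwise \<open>a'\<close> is a value of
    \<open>deriv g\<close>, hence not a root of \<open>t^3 - t\<close>.\<close>
  obtain a where a: "a \<notin> {0, 1, - 1}" "\<And>t. t \<in> f ` \<Omega> \<Longrightarrow> g t = a * t + b"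
  proof (cases "\<Omega> = {}")
    case True
    then show thesis using that[of 2] by simp
  next
    case False
    then obtain t where t: "t \<in> f ` \<Omega>" by auto
    then have "a' ^ 3 - a' \<noteq> 0" using assms(6)[of t] a'(2)[OF t] g(3) by auto
    then have "a' \<notin> {0, 1, - 1}" by auto
    with a'(1) show thesis using that by blast
  qed
  have gf: "(g \<circ> f) p = a * f p + b" if "p \<in> \<Omega>" for p using a(2) that by simp
  have "grad f p \<noteq> 0" if "p \<in> \<Omega>" for p using assms(4)[OF that] by auto
  then have "is_plane \<Omega> f \<or> is_helicoid \<Omega> f"
    by (rule harmonic_straight_levels_imp_plane_or_helicoid[OF assms(1,2) f _
        minimal_affine_image_imp_harmonic[OF assms(3) g(4) gf a(1)]])
  moreover have "is_plane \<Omega> f \<longrightarrow> is_plane \<Omega> (g \<circ> f)"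
    using is_plane_affine[of \<Omega> f "g \<circ> f" a b] gf by blast
  moreover have "is_helicoid \<Omega> f \<longrightarrow> is_helicoid \<Omega> (g \<circ> f)"
    using is_helicoid_affine[of \<Omega> f "g \<circ> f" a b] gf a(1) by simp
  ultimately show ?thesis using a by blast
qed

end
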